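(* There is no algorithm (in the exploration model described in the context) that successfully explores every finite tree and whose assigned nonzero colors, over all trees and all adversaries, all belong to a fixed set of at most $2$ colors.
   Context: Exploration model. Graphs are finite, simple, undirected and connected; vertices are anonymous and edges carry no port labels. Each vertex carries a color in $\mathbb{N}=\{0,1,2,\dots\}$, where $0$ means "uncolored"; initially all vertices have color $0$. An algorithm is a function $\mathrm{move}$ mapping every environment $(c_0,E)$ — where $c_0\in\mathbb{N}$ is the color of the agent's current vertex and $E:\mathbb{N}\to\mathbb{N}$ (zero almost everywhere) gives, for each color $c$, the number $E(c)$ of neighbors of the current vertex having color $c$ — either to $\mathrm{Stop}$ or to a pair $(c_1,d)\in\mathbb{N}\times\mathbb{N}$ with $E(d)>0$, subject to $c_1=c_0$ whenever $c_0\neq 0$ (a vertex may only be colored while it is uncolored). A run on a graph $G$: an adversary chooses a start vertex $v_0$ and places the agent there; in each step, with the agent at $v$, $\mathrm{move}$ is evaluated at the environment of $v$; if the value is $\mathrm{Stop}$ the run ends, and if it is $(c_1,d)$ then $v$ receives color $c_1$ and the adversary chooses an arbitrary neighbor of $v$ of color $d$, to which the agent moves. The agent has no other memory. A vertex is visited if the agent is located at it in some step. An algorithm successfully explores $G$ if for every adversary (every choice of start vertex and of neighbors), after finitely many steps all vertices have been visited, the agent is at $v_0$, and the decision is $\mathrm{Stop}$. *)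

theory Defs
  imports "Graph_Theory.Pair_Digraph" "Graph_Theory.Digraph_Component"
begin

text \<open>
  An undirected graph is a finite, symmetric, loop-free set of arcs (the locale
  \<open>pair_graph\<close>). The library predicate \<open>tree\<close> is not usable here: in a symmetric
  digraph the closed walk \<open>u, v, u\<close> is a directed cycle, so no symmetric graph with an edge
  is a \<open>forest\<close> in the library's sense. The undirected cycles are exactly the directed cycles
  of length at least 3. Note that \<open>connected\<close> entails non-emptiness.
\<close>

definition finite_tree :: "'v pair_pre_digraph \<Rightarrow> bool" where
  "finite_tree G \<longleftrightarrow>
     pair_graph G \<and>
     Digraph_Component.connected (with_proj G) \<and>
     \<not> (\<exists>p. pre_digraph.cycle (with_proj G) p \<and> 3 \<le> length p)"

datatype decision = Stop | Go (paint: nat) (target: nat)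

type_synonym algorithm = "nat \<Rightarrow> (nat \<Rightarrow> nat) \<Rightarrow> decision"

text \<open>Environments have finite support; the values of an algorithm elsewhere are irrelevant.\<close>

definition is_algorithm :: "algorithm \<Rightarrow> bool" where
  "is_algorithm mv \<longleftrightarrow>
     (\<forall>c0 E. finite {c. E c \<noteq> 0} \<longrightarrow>
        (\<forall>c1 d. mv c0 E = Go c1 d \<longrightarrow> 0 < E d \<and> (c0 \<noteq> 0 \<longrightarrow> c1 = c0)))"

text \<open>A configuration consists of the current coloring and the position of the agent.\<close>

type_synonym 'v config = "('v \<Rightarrow> nat) \<times> 'v"

definition environment :: "'v pair_pre_digraph \<Rightarrow> ('v \<Rightarrow> nat) \<Rightarrow> 'v \<Rightarrow> nat \<Rightarrow> nat" where
  "environment G \<kappa> v = (\<lambda>c. card {w. (v, w) \<in> parcs G \<and> \<kappa> w = c})"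

fun decide :: "'v pair_pre_digraph \<Rightarrow> algorithm \<Rightarrow> 'v config \<Rightarrow> decision" where
  "decide G mv (\<kappa>, v) = mv (\<kappa> v) (environment G \<kappa> v)"

fun step :: "'v pair_pre_digraph \<Rightarrow> algorithm \<Rightarrow> 'v config \<Rightarrow> 'v config \<Rightarrow> bool" where
  "step G mv (\<kappa>, v) (\<kappa>', w) \<longleftrightarrow>
     (\<exists>c1 d. decide G mv (\<kappa>, v) = Go c1 d \<and>
        \<kappa>' = \<kappa>(v := c1) \<and> (v, w) \<in> parcs G \<and> \<kappa> w = d)"

text \<open>
  The choices of the adversary are represented by the runs they give rise to. A run that has
  ended is padded by repeating its last configuration forever.
\<close>

definition run :: "'v pair_pre_digraph \<Rightarrow> algorithm \<Rightarrow> 'v \<Rightarrow> (nat \<Rightarrow> 'v config) \<Rightarrow> bool" where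
  "run G mv v0 \<rho> \<longleftrightarrow>
     \<rho> 0 = (\<lambda>_. 0, v0) \<and>
     (\<forall>n. if decide G mv (\<rho> n) = Stop then \<rho> (Suc n) = \<rho> n
          else step G mv (\<rho> n) (\<rho> (Suc n)))"

definition successfully_explores :: "algorithm \<Rightarrow> 'v pair_pre_digraph \<Rightarrow> bool" where
  "successfully_explores mv G \<longleftrightarrow>
     (\<forall>v0 \<in> pverts G. \<forall>\<rho>. run G mv v0 \<rho> \<longrightarrow>
        (\<exists>n. decide G mv (\<rho> n) = Stop \<and> snd (\<rho> n) = v0 \<and>
             (\<forall>u \<in> pverts G. \<exists>i \<le> n. snd (\<rho> i) = u)))"

definition assigned_colors :: "algorithm \<Rightarrow> 'v pair_pre_digraph \<Rightarrow> nat set" where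
  "assigned_colors mv G =
     {c. c \<noteq> 0 \<and> (\<exists>v0 \<in> pverts G. \<exists>\<rho> n d. run G mv v0 \<rho> \<and> decide G mv (\<rho> n) = Go c d)}"

end

theory Submission
  imports Defs
begin

text \<open>
  Already on paths every algorithm with two colors fails. A run never stops once two adjacent
  vertices send the agent to each other's color without changing their own, and no run may stop
  while an end of the path is unvisited. So, as long as this is the case, the agent has to move and
  no such pair may arise. The start vertex must take a color \<open>s\<close>; a case distinction on the
  decisions at an uncolored vertex with neighbors colored \<open>s, 0\<close> and then \<open>t, 0\<close>, where \<open>t\<close> is the
  other color, always leads to such a pair. If the agent just paints its way forward, each color
  depends only on the preceding one, so near the leaf the coloring has period at most two and the
  agent returning from the leaf cannot tell the two sides apart.
\<close>

section \<open>Paths are trees\<close>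

definition path_graph :: "nat \<Rightarrow> nat pair_pre_digraph" where
  "path_graph n =
     \<lparr>pverts = {..<n}, parcs = {(i, j). i < n \<and> j < n \<and> (j = Suc i \<or> i = Suc j)}\<rparr>"

lemma pverts_path_graph [simp]: "pverts (path_graph n) = {..<n}"
  by (simp add: path_graph_def)

lemma parcs_path_graph [simp]:
  "(i, j) \<in> parcs (path_graph n) \<longleftrightarrow> i < n \<and> j < n \<and> (j = Suc i \<or> i = Suc j)"
  by (simp add: path_graph_def)

lemma pair_graph_path_graph: "pair_graph (path_graph n)"
proof -
  have "parcs (path_graph n) \<subseteq> {..<n} \<times> {..<n}"
    by auto
  then have "finite (parcs (path_graph n))"
    by (rule finite_subset) simp
  then show ?thesis
    by unfold_locales (auto simp: symmetric_def sym_def)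
qed

lemma connected_path_graph:
  assumes "0 < n"
  shows "Digraph_Component.connected (with_proj (path_graph n))"
proof -
  let ?S = "rtrancl_on {..<n} ((parcs (path_graph n))\<^sup>s)"
  have up: "(0, i) \<in> ?S" if "i < n" for i
    using that
  proof (induction i)
    case (Suc i)
    then have "(i, Suc i) \<in> (parcs (path_graph n))\<^sup>s"
      by (auto simp: symcl_def)
    with Suc show ?case
      by (auto intro: rtrancl_on_into_rtrancl_on)
  qed (simp add: rtrancl_on_refl)
  have down: "(i, 0) \<in> ?S" if "i < n" for i
    using that
  proof (induction i)
    case (Suc i)
    then have "(Suc i, i) \<in> (parcs (path_graph n))\<^sup>s"
      by (auto simp: symcl_def)
    with Suc show ?case
      by (auto intro: converse_rtrancl_on_into_rtrancl_on)
  qed (simp add: rtrancl_on_refl)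
  have "(i, j) \<in> ?S" if "i < n" "j < n" for i j
    using down [OF that(1)] up [OF that(2)] by (rule rtrancl_on_trans)
  moreover have "pverts (path_graph n) \<noteq> {}"
    using assms by auto
  ultimately show ?thesis
    by (simp add: connected_conv)
qed

text \<open>On a path, a vertex has only one neighbor besides the one just left. So once the walk
  has come up from \<open>u\<close> and does not turn at once, distinctness forbids every later
  reversal.\<close>

lemma nonbacktracking_walk_up:
  assumes "set es \<subseteq> parcs (path_graph n)" "pcas v es w" "v = Suc u"
    and "es \<noteq> [] \<Longrightarrow> snd (hd es) \<noteq> u" "distinct (v # map snd es)"
  shows "v \<le> w"
  using assms
proof (induction es arbitrary: u v)
  case (Cons e es)
  have e: "snd e = Suc v"
    using Cons.prems by (cases e) auto
  have "snd (hd es) \<noteq> v" if "es \<noteq> []"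
    using that Cons.prems(5) by (cases es) auto
  then have "snd e \<le> w"
    using Cons.prems e by (intro Cons.IH [of _ v]) auto
  with e show ?case
    by simp
qed simp

lemma nonbacktracking_walk_down:
  assumes "set es \<subseteq> parcs (path_graph n)" "pcas v es w" "u = Suc v"
    and "es \<noteq> [] \<Longrightarrow> snd (hd es) \<noteq> u" "distinct (v # map snd es)"
  shows "w \<le> v"
  using assms
proof (induction es arbitrary: u v)
  case (Cons e es)
  have e: "v = Suc (snd e)"
    using Cons.prems by (cases e) auto
  have "snd (hd es) \<noteq> v" if "es \<noteq> []"
    using that Cons.prems(5) by (cases es) auto
  then have "w \<le> snd e"
    using Cons.prems e by (intro Cons.IH [of _ v]) auto
  with e show ?case
    by simp
qed simp

lemma pcas_last: "pcas u es w \<Longrightarrow> es \<noteq> [] \<Longrightarrow> snd (last es) = w"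
  by (induction es arbitrary: u) (auto split: if_splits)

text \<open>After its first arc a cycle of length at least 3 cannot turn back, so it moves
  monotonically away from its base point and never closes up.\<close>

lemma no_long_cycle_path_graph:
  assumes "pre_digraph.cycle (with_proj (path_graph n)) p"
  shows "length p < 3"
proof (rule ccontr)
  assume "\<not> length p < 3"
  then obtain e1 e2 e3 es where p: "p = e1 # e2 # e3 # es"
    by (metis One_nat_def Suc_1 length_Cons less_Suc_eq_0_disj list.exhaust list.size(3)
        numeral_3_eq_3)
  obtain u where arcs: "set p \<subseteq> parcs (path_graph n)" and walk: "pcas u p u"
    and dist: "distinct (map snd p)"
    using assms p
    by (auto simp: pre_digraph.cycle_def pre_digraph.awalk_def cas_with_proj_eq
        pre_digraph.awalk_verts_conv' )
  have "snd (last (e3 # es)) = u"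
    using pcas_last [OF walk] p by simp
  then have "u \<in> snd ` set (e3 # es)"
    by (metis image_eqI last_in_set list.discI)
  \<comment> \<open>The base point is entered by the last arc, which lies beyond \<open>e2\<close>
    because there are at least three arcs; heads of arcs are distinct.\<close>
  then have ne: "snd e2 \<noteq> u"
    using dist p by auto
  have step: "snd e1 = Suc u \<or> u = Suc (snd e1)"
    using arcs walk p by (cases e1) auto
  have tail: "set (e2 # e3 # es) \<subseteq> parcs (path_graph n)" "pcas (snd e1) (e2 # e3 # es) u"
    "distinct (snd e1 # map snd (e2 # e3 # es))"
    using arcs walk dist p by auto
  from step show False
  proof
    assume "snd e1 = Suc u"
    with nonbacktracking_walk_up [OF tail(1,2) _ _ tail(3)] ne show False
      by fastforce
  next
    assume "u = Suc (snd e1)"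
    with nonbacktracking_walk_down [OF tail(1,2) _ _ tail(3)] ne show False
      by fastforce
  qed
qed

lemma finite_tree_path_graph: "0 < n \<Longrightarrow> finite_tree (path_graph n)"
  using pair_graph_path_graph connected_path_graph no_long_cycle_path_graph
  by (auto simp: finite_tree_def not_le)

section \<open>Runs from arbitrary configurations\<close>

text \<open>Freeing the initial configuration allows runs to be glued together from a finite prefix
  and a prescribed continuation.\<close>

definition run_from ::
  "'v pair_pre_digraph \<Rightarrow> algorithm \<Rightarrow> 'v config \<Rightarrow> (nat \<Rightarrow> 'v config) \<Rightarrow> bool" where
  "run_from G mv X \<rho> \<longleftrightarrow>
     \<rho> 0 = X \<and>
     (\<forall>n. if decide G mv (\<rho> n) = Stop then \<rho> (Suc n) = \<rho> n
          else step G mv (\<rho> n) (\<rho> (Suc n)))"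

lemma run_iff_run_from: "run G mv v0 \<rho> \<longleftrightarrow> run_from G mv (\<lambda>_. 0, v0) \<rho>"
  by (simp add: run_def run_from_def)

lemma step_not_Stop: "step G mv X Y \<Longrightarrow> decide G mv X \<noteq> Stop"
  by (cases X; cases Y) auto

lemma run_from_Cons:
  assumes "step G mv X Y" "run_from G mv Y \<rho>"
  shows "run_from G mv X (case_nat X \<rho>)"
  using assms step_not_Stop [OF assms(1)] by (auto simp: run_from_def split: nat.split)

abbreviation step_avoiding ::
  "'v \<Rightarrow> 'v pair_pre_digraph \<Rightarrow> algorithm \<Rightarrow> 'v config \<Rightarrow> 'v config \<Rightarrow> bool" where
  "step_avoiding u G mv \<equiv> \<lambda>X Y. step G mv X Y \<and> snd X \<noteq> u \<and> snd Y \<noteq> u"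

text \<open>The gluing of adversary strategies: \<open>k\<close> is the length of the prefix leading
  to \<open>Y\<close>, during which \<open>u\<close> stays unvisited and the agent never
  stops.\<close>

lemma run_from_prepend:
  assumes "(step_avoiding u G mv)\<^sup>*\<^sup>* X Y" "run_from G mv Y \<sigma>"
  shows "\<exists>\<rho> k. run_from G mv X \<rho> \<and> (\<forall>i. \<rho> (i + k) = \<sigma> i) \<and>
           (\<forall>i<k. snd (\<rho> i) \<noteq> u \<and> decide G mv (\<rho> i) \<noteq> Stop)"
  using assms(1)
proof (induction rule: converse_rtranclp_induct)
  case base
  then show ?case
    using assms(2) by (intro exI [of _ \<sigma>] exI [of _ 0]) auto
next
  case (step X Z)
  then obtain \<rho> k where rho: "run_from G mv Z \<rho>" "\<forall>i. \<rho> (i + k) = \<sigma> i"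
    "\<forall>i<k. snd (\<rho> i) \<noteq> u \<and> decide G mv (\<rho> i) \<noteq> Stop"
    by blast
  have "run_from G mv X (case_nat X \<rho>)"
    using step(1) rho(1) by (intro run_from_Cons) auto
  moreover have "\<forall>i<Suc k. snd (case_nat X \<rho> i) \<noteq> u \<and> decide G mv (case_nat X \<rho> i) \<noteq> Stop"
    using step(1) rho(3) step_not_Stop [of G mv X Z] by (simp add: All_less_Suc2)
  ultimately show ?case
    using rho(2) by (intro exI [of _ "case_nat X \<rho>"] exI [of _ "Suc k"]) auto
qed

text \<open>Stopping at \<open>X\<close> would complete a run in which \<open>u\<close> is never
  visited.\<close>

lemma no_premature_Stop:
  assumes "successfully_explores mv G" "v0 \<in> pverts G" "u \<in> pverts G"
    and "(step_avoiding u G mv)\<^sup>*\<^sup>* (\<lambda>_. 0, v0) X" "snd X \<noteq> u"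
  shows "decide G mv X \<noteq> Stop"
proof
  assume "decide G mv X = Stop"
  then have "run_from G mv X (\<lambda>_. X)"
    by (simp add: run_from_def)
  then obtain \<rho> k where rho: "run_from G mv (\<lambda>_. 0, v0) \<rho>" "\<forall>i. \<rho> (i + k) = X"
    "\<forall>i<k. snd (\<rho> i) \<noteq> u"
    using run_from_prepend [OF assms(4)] by blast
  have "snd (\<rho> i) \<noteq> u" for i
    using rho(2,3) assms(5) by (metis le_add_diff_inverse2 not_less)
  with rho(1) assms(1-3) show False
    by (auto simp: successfully_explores_def run_iff_run_from)
qed

text \<open>The adversary could alternate between \<open>X\<close> and \<open>Y\<close> forever,
  giving a run that never stops.\<close>

lemma no_two_cycle:
  assumes "successfully_explores mv G" "v0 \<in> pverts G"
    and "(step_avoiding u G mv)\<^sup>*\<^sup>* (\<lambda>_. 0, v0) X" "step G mv X Y"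
  shows "\<not> step G mv Y X"
proof
  assume YX: "step G mv Y X"
  then have "run_from G mv X (\<lambda>n. if even n then X else Y)"
    using assms(4) step_not_Stop [OF YX] step_not_Stop [OF assms(4)] by (auto simp: run_from_def)
  then obtain \<rho> k where rho: "run_from G mv (\<lambda>_. 0, v0) \<rho>"
    "\<forall>i. \<rho> (i + k) = (if even i then X else Y)" "\<forall>i<k. decide G mv (\<rho> i) \<noteq> Stop"
    using run_from_prepend [OF assms(3)] by blast
  have "decide G mv (\<rho> i) \<noteq> Stop" for i
  proof (cases "i < k")
    case False
    then have "\<rho> i = (if even (i - k) then X else Y)"
      using rho(2) [rule_format, of "i - k"] by simp
    then show ?thesis
      using step_not_Stop [OF YX] step_not_Stop [OF assms(4)] by simp
  qed (use rho(3) in blast)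
  with rho(1) assms(1,2) show False
    by (auto simp: successfully_explores_def run_iff_run_from)
qed

section \<open>Existence of runs and the colors they assign\<close>

lemma environment_pos_iff:
  assumes "finite (parcs G)"
  shows "0 < environment G \<kappa> v c \<longleftrightarrow> (\<exists>w. (v, w) \<in> parcs G \<and> \<kappa> w = c)"
proof -
  have "finite {w. (v, w) \<in> parcs G \<and> \<kappa> w = c}"
    by (rule finite_subset [OF _ finite_imageI [OF assms, of snd]]) force
  then show ?thesis
    by (auto simp: environment_def card_gt_0_iff)
qed

lemma finite_environment_support:
  assumes "finite (parcs G)"
  shows "finite {c. environment G \<kappa> v c \<noteq> 0}"
proof (rule finite_subset)
  show "{c. environment G \<kappa> v c \<noteq> 0} \<subseteq> (\<lambda>e. \<kappa> (snd e)) ` parcs G"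
    using environment_pos_iff [OF assms] by force
qed (use assms in simp)

lemma step_exists:
  assumes "is_algorithm mv" "finite (parcs G)" "decide G mv X \<noteq> Stop"
  shows "\<exists>Y. step G mv X Y"
proof -
  obtain \<kappa> v where X: "X = (\<kappa>, v)"
    by fastforce
  obtain c d where move: "mv (\<kappa> v) (environment G \<kappa> v) = Go c d"
    using assms(3) X by (cases "decide G mv X") auto
  then have "environment G \<kappa> v d > 0"
    using assms(1) finite_environment_support [OF assms(2)] by (simp add: is_algorithm_def)
  then obtain w where "(v, w) \<in> parcs G" "\<kappa> w = d"
    using environment_pos_iff [OF assms(2)] by blast
  with move X show ?thesis
    by auto
qed

lemma run_from_exists:
  assumes "is_algorithm mv" "finite (parcs G)"
  shows "\<exists>\<rho>. run_from G mv X \<rho>"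
proof -
  define next_config where
    "next_config Y = (if decide G mv Y = Stop then Y else SOME Z. step G mv Y Z)" for Y
  have "step G mv Y (next_config Y)" if "decide G mv Y \<noteq> Stop" for Y
    using that someI_ex [OF step_exists [OF assms that]] by (simp add: next_config_def)
  then have "run_from G mv X (\<lambda>n. (next_config ^^ n) X)"
    by (simp add: run_from_def next_config_def)
  then show ?thesis
    by (rule exI [where x = "\<lambda>n. (next_config ^^ n) X"])
qed

text \<open>\<open>assigned_colors\<close> speaks of infinite runs, so the finite history leading to
  \<open>X\<close> has to be extended to one.\<close>

lemma reachable_paint_assigned:
  assumes "is_algorithm mv" "finite (parcs G)" "v0 \<in> pverts G"
    and "(step_avoiding u G mv)\<^sup>*\<^sup>* (\<lambda>_. 0, v0) X" "decide G mv X = Go c d" "c \<noteq> 0"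
  shows "c \<in> assigned_colors mv G"
proof -
  obtain \<sigma> where "run_from G mv X \<sigma>"
    using run_from_exists [OF assms(1,2)] by blast
  moreover from this have "\<sigma> 0 = X"
    by (simp add: run_from_def)
  ultimately obtain \<rho> k where "run G mv v0 \<rho>" "\<rho> k = X"
    using run_from_prepend [OF assms(4)] by (metis add_0 run_iff_run_from)
  with assms show ?thesis
    unfolding assigned_colors_def by blast
qed

section \<open>Configurations on a path\<close>

text \<open>The left part is listed starting from the agent, so its last element is the color of vertex 0.\<close>

definition zipper :: "nat list \<Rightarrow> nat \<Rightarrow> nat list \<Rightarrow> nat config" where
  "zipper l c r =
     (\<lambda>i. if i \<le> length l + length r then (rev l @ c # r) ! i else 0, length l)"

section \<open>Environments and steps on a path\<close>

definition env2 :: "nat \<Rightarrow> nat \<Rightarrow> nat \<Rightarrow> nat" where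
  "env2 p q = (\<lambda>x. (if p = x then 1 else 0) + (if q = x then 1 else 0))"

definition env1 :: "nat \<Rightarrow> nat \<Rightarrow> nat" where
  "env1 p = (\<lambda>x. if p = x then 1 else 0)"

lemma environment_inner:
  assumes "Suc (Suc i) < n"
  shows "environment (path_graph n) \<kappa> (Suc i) = env2 (\<kappa> i) (\<kappa> (Suc (Suc i)))"
proof
  fix x
  have "{w. (Suc i, w) \<in> parcs (path_graph n) \<and> \<kappa> w = x} =
    (if \<kappa> i = x then {i} else {}) \<union> (if \<kappa> (Suc (Suc i)) = x then {Suc (Suc i)} else {})"
    using assms by auto
  then show "environment (path_graph n) \<kappa> (Suc i) x = env2 (\<kappa> i) (\<kappa> (Suc (Suc i))) x"
    by (simp add: environment_def env2_def)
qed

lemma environment_right_end: "environment (path_graph (Suc (Suc i))) \<kappa> (Suc i) = env1 (\<kappa> i)"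
proof
  fix x
  have "{w. (Suc i, w) \<in> parcs (path_graph (Suc (Suc i))) \<and> \<kappa> w = x} =
    (if \<kappa> i = x then {i} else {})"
    by auto
  then show "environment (path_graph (Suc (Suc i))) \<kappa> (Suc i) x = env1 (\<kappa> i) x"
    by (simp add: environment_def env1_def)
qed

lemma decide_zipper:
  assumes "n = length l + length r + 3"
  shows "decide (path_graph n) mv (zipper (p # l) c (q # r)) = mv c (env2 p q)"
  using assms by (simp add: zipper_def environment_inner nth_append)

lemma decide_zipper_end:
  assumes "n = length l + 2"
  shows "decide (path_graph n) mv (zipper (p # l) c []) = mv c (env1 p)"
  using assms by (simp add: zipper_def environment_right_end nth_append)

text \<open>For \<open>p = q\<close> the decision does not single out a neighbor. Then both this
  lemma and its left counterpart apply, which is the freedom of the adversary on a path.\<close>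

lemma step_zipper_right:
  assumes "n = length l + length r + 3" "mv c (env2 p q) = Go c' q"
  shows "step (path_graph n) mv (zipper (p # l) c (q # r)) (zipper (c' # p # l) q r)"
  using decide_zipper [OF assms(1), of mv p c q] assms
  by (auto simp: zipper_def nth_append fun_eq_iff nth_Cons split: nat.split)

lemma step_zipper_left:
  assumes "n = length l + length r + 3" "mv c (env2 p q) = Go c' p"
  shows "step (path_graph n) mv (zipper (p # l) c (q # r)) (zipper l p (c' # q # r))"
  using decide_zipper [OF assms(1), of mv p c q] assms
  by (auto simp: zipper_def nth_append fun_eq_iff nth_Cons split: nat.split)

lemma step_zipper_end:
  assumes "n = length l + 2" "mv c (env1 p) = Go c' p"
  shows "step (path_graph n) mv (zipper (p # l) c []) (zipper l p [c'])"
  using decide_zipper_end [OF assms(1), of mv p c] assms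
  by (auto simp: zipper_def nth_append fun_eq_iff nth_Cons split: nat.split)

text \<open>Since a zipper colors everything beyond the path with 0, an all-zero one is literally an
  initial configuration of a run.\<close>

lemma zipper_zeros:
  assumes "set l \<subseteq> {0}" "set r \<subseteq> {0}"
  shows "zipper l 0 r = (\<lambda>_. 0, length l)"
proof -
  have "(rev l @ 0 # r) ! i = 0" if "i \<le> length l + length r" for i
    using that assms nth_mem [of i "rev l @ 0 # r"] by auto
  then show ?thesis
    by (auto simp: zipper_def)
qed

section \<open>Two colors do not suffice on paths\<close>

text \<open>The agent cannot tell left from right; all mirrored arguments and many of the swaps rest
  on this.\<close>

lemma env2_commute: "env2 p q = env2 q p"
  by (simp add: env2_def add.commute)

section \<open>Configurations reachable while an end of the path is unvisited\<close>

locale path_explorer =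
  fixes mv :: algorithm and C :: "nat set"
  assumes algorithm: "is_algorithm mv"
    and explores: "\<And>n. 0 < n \<Longrightarrow> successfully_explores mv (path_graph n)"
    and colors: "\<And>n. 0 < n \<Longrightarrow> assigned_colors mv (path_graph n) \<subseteq> C"
begin

text \<open>Vertex 0 is the unvisited end, and \<open>l \<noteq> []\<close> keeps the agent off it.
  The lists determine the length of the path; the start vertex \<open>k\<close> is left open, as the
  adversary chooses it.\<close>

definition reachable :: "nat list \<Rightarrow> nat \<Rightarrow> nat list \<Rightarrow> bool" where
  "reachable l c r \<longleftrightarrow> l \<noteq> [] \<and>
     (let n = length l + length r + 1 in
        \<exists>k<n. (step_avoiding 0 (path_graph n) mv)\<^sup>*\<^sup>* (\<lambda>_. 0, k) (zipper l c r))"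

lemma reachable_start:
  assumes "set l \<subseteq> {0}" "set r \<subseteq> {0}" "l \<noteq> []"
  shows "reachable l 0 r"
  using assms
  by (auto simp: reachable_def Let_def zipper_zeros intro!: exI [of _ "length l"])

lemma reachable_step:
  assumes "reachable l c r" "length l' + length r' = length l + length r" "l' \<noteq> []"
    and "step (path_graph (length l + length r + 1)) mv (zipper l c r) (zipper l' c' r')"
  shows "reachable l' c' r'"
proof -
  define n where "n = length l + length r + 1"
  obtain k where k: "k < n" "(step_avoiding 0 (path_graph n) mv)\<^sup>*\<^sup>* (\<lambda>_. 0, k) (zipper l c r)"
    using assms(1) by (auto simp: reachable_def Let_def n_def)
  have "snd (zipper l c r) \<noteq> 0" "snd (zipper l' c' r') \<noteq> 0"
    using assms(1,3) by (auto simp: reachable_def zipper_def)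
  then have "(step_avoiding 0 (path_graph n) mv)\<^sup>*\<^sup>* (\<lambda>_. 0, k) (zipper l' c' r')"
    using rtranclp.rtrancl_into_rtrancl [OF k(2)] assms(4) by (simp add: n_def)
  with k(1) assms(2,3) show ?thesis
    by (auto simp: reachable_def Let_def n_def)
qed

lemma reachable_right:
  assumes "reachable (p # l) c (q # r)" "mv c (env2 p q) = Go c' q"
  shows "reachable (c' # p # l) q r"
  using reachable_step [OF assms(1), of "c' # p # l" r q] step_zipper_right [of _ l r mv c p q c']
    assms(2)
  by auto

lemma reachable_left:
  assumes "reachable (p # l) c (q # r)" "mv c (env2 p q) = Go c' p" "l \<noteq> []"
  shows "reachable l p (c' # q # r)"
  using reachable_step [OF assms(1), of l "c' # q # r" p] step_zipper_left [of _ l r mv c p q c']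
    assms(2,3)
  by auto

lemma reachable_return:
  assumes "reachable (p # l) c []" "mv c (env1 p) = Go c' p" "l \<noteq> []"
  shows "reachable l p [c']"
  using reachable_step [OF assms(1), of l "[c']" p] step_zipper_end [of _ l mv c p c'] assms(2,3)
  by auto

text \<open>With vertex 0 unvisited the agent may not stop, and the color it assigns occurs in an
  actual run, hence is 0 or in \<open>C\<close>.\<close>

lemma reachable_Go:
  assumes "reachable l c r"
  obtains c' d where "decide (path_graph (length l + length r + 1)) mv (zipper l c r) = Go c' d"
    and "c' \<in> insert 0 C"
proof -
  define n where "n = length l + length r + 1"
  obtain k where k: "k < n" "(step_avoiding 0 (path_graph n) mv)\<^sup>*\<^sup>* (\<lambda>_. 0, k) (zipper l c r)"
    using assms by (auto simp: reachable_def Let_def n_def)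
  interpret pair_graph "path_graph n"
    by (rule pair_graph_path_graph)
  have "snd (zipper l c r) \<noteq> 0"
    using assms by (auto simp: reachable_def zipper_def)
  then have "decide (path_graph n) mv (zipper l c r) \<noteq> Stop"
    using no_premature_Stop [OF explores _ _ k(2)] k(1) by (simp add: n_def)
  then obtain c' d where go: "decide (path_graph n) mv (zipper l c r) = Go c' d"
    by (cases "decide (path_graph n) mv (zipper l c r)") auto
  moreover have "c' \<in> C" if "c' \<noteq> 0"
    using reachable_paint_assigned [OF algorithm pair_finite_arcs _ k(2) go that] k(1) colors [of n]
    by (auto simp: n_def)
  ultimately show thesis
    using that unfolding n_def by auto
qed

lemma reachable_no_two_cycle:
  assumes "reachable l c r"
    and "step (path_graph (length l + length r + 1)) mv (zipper l c r) Y"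
  shows "\<not> step (path_graph (length l + length r + 1)) mv Y (zipper l c r)"
proof -
  define n where "n = length l + length r + 1"
  obtain k where k: "k < n" "(step_avoiding 0 (path_graph n) mv)\<^sup>*\<^sup>* (\<lambda>_. 0, k) (zipper l c r)"
    using assms(1) by (auto simp: reachable_def Let_def n_def)
  then show ?thesis
    using no_two_cycle [OF explores _ k(2)] assms(2) unfolding n_def by simp
qed

lemma reachable_decision:
  assumes "reachable (p # l) c (q # r)"
  shows "\<exists>c'\<in>insert 0 C.
    (mv c (env2 p q) = Go c' p \<or> mv c (env2 p q) = Go c' q) \<and> (c \<noteq> 0 \<longrightarrow> c' = c)"
proof -
  obtain c' d where go: "mv c (env2 p q) = Go c' d" "c' \<in> insert 0 C"
    using reachable_Go [OF assms] decide_zipper [of _ l r mv p c q] by auto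
  have "finite {x. env2 p q x \<noteq> 0}"
    by (simp add: env2_def)
  then have "0 < env2 p q d" "c \<noteq> 0 \<longrightarrow> c' = c"
    using algorithm go(1) unfolding is_algorithm_def by blast+
  with go show ?thesis
    by (auto simp: env2_def split: if_splits)
qed

lemma reachable_leaf_decision:
  assumes "reachable (p # l) c []"
  shows "\<exists>c'\<in>insert 0 C. mv c (env1 p) = Go c' p \<and> (c \<noteq> 0 \<longrightarrow> c' = c)"
proof -
  obtain c' d where go: "mv c (env1 p) = Go c' d" "c' \<in> insert 0 C"
    using reachable_Go [OF assms] decide_zipper_end [of _ l mv p c] by auto
  have "finite {x. env1 p x \<noteq> 0}"
    by (simp add: env1_def)
  then have "0 < env1 p d" "c \<noteq> 0 \<longrightarrow> c' = c"
    using algorithm go(1) unfolding is_algorithm_def by blast+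
  with go show ?thesis
    by (auto simp: env1_def split: if_splits)
qed

text \<open>Two neighbors that keep their colors and point to each other trap the agent. The color 0
  is included: an uncolored vertex may be left uncolored.\<close>

lemma reachable_no_swap_right:
  assumes "reachable (p # l) c (q # q' # r)" "mv c (env2 p q) = Go c q"
  shows "mv q (env2 c q') \<noteq> Go q c"
proof
  assume ret: "mv q (env2 c q') = Go q c"
  have n: "length (p # l) + length (q # q' # r) + 1 = length l + length (q' # r) + 3"
    "length (p # l) + length (q # q' # r) + 1 = length (p # l) + length r + 3"
    by simp_all
  from reachable_no_two_cycle [OF assms(1) step_zipper_right [where mv = mv, OF n(1) assms(2)]]
    step_zipper_left [where mv = mv, OF n(2) ret]
  show False ..
qed

lemma reachable_no_swap_left:
  assumes "reachable (p # p' # l) c (q # r)" "mv c (env2 p q) = Go c p"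
  shows "mv p (env2 p' c) \<noteq> Go p c"
proof
  assume ret: "mv p (env2 p' c) = Go p c"
  have n: "length (p # p' # l) + length (q # r) + 1 = length (p' # l) + length r + 3"
    "length (p # p' # l) + length (q # r) + 1 = length l + length (q # r) + 3"
    by simp_all
  from reachable_no_two_cycle [OF assms(1) step_zipper_left [where mv = mv, OF n(1) assms(2)]]
    step_zipper_right [where mv = mv, OF n(2) ret]
  show False ..
qed

lemma reachable_no_swap_leaf:
  assumes "reachable (p # l) c [q]" "mv c (env2 p q) = Go c q"
  shows "mv q (env1 c) \<noteq> Go q c"
proof
  assume ret: "mv q (env1 c) = Go q c"
  have n: "length (p # l) + length [q] + 1 = length l + length ([] :: nat list) + 3"
    "length (p # l) + length [q] + 1 = length (p # l) + 2"
    by simp_all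
  from reachable_no_two_cycle [OF assms(1) step_zipper_right [where mv = mv, OF n(1) assms(2)]]
    step_zipper_end [where mv = mv, OF n(2) ret]
  show False ..
qed

text \<open>
  The flag tells which end of the path is known to be unvisited, so that the mirror images of all
  arguments come for free.
\<close>

definition reach :: "bool \<Rightarrow> nat list \<Rightarrow> nat \<Rightarrow> nat list \<Rightarrow> bool" where
  "reach left l c r \<longleftrightarrow> (if left then reachable l c r else reachable r c l)"

lemma reach_True: "reach True l c r \<longleftrightarrow> reachable l c r"
  and reach_False: "reach False l c r \<longleftrightarrow> reachable r c l"
  by (simp_all add: reach_def)

lemmas reach_return = reachable_return [folded reach_True]
lemmas leaf_decision = reachable_leaf_decision [folded reach_True]
lemmas no_swap_leaf = reachable_no_swap_leaf [folded reach_True]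

lemma reach_start:
  assumes "set l \<subseteq> {0}" "set r \<subseteq> {0}" "if left then l \<noteq> [] else r \<noteq> []"
  shows "reach left l 0 r"
  using assms reachable_start by (simp add: reach_def split: if_splits)

text \<open>The last premise prevents the agent from entering the unvisited end when that end is on
  the right.\<close>

lemma reach_right:
  assumes "reach left (p # l) c (q # r)" "mv c (env2 p q) = Go c' q" "left \<or> r \<noteq> []"
  shows "reach left (c' # p # l) q r"
  using assms reachable_right reachable_left [of q r c p l c']
  by (auto simp: reach_def env2_commute [of q p] split: if_splits)

lemma reach_left:
  assumes "reach left (p # l) c (q # r)" "mv c (env2 p q) = Go c' p" "\<not> left \<or> l \<noteq> []"
  shows "reach left l p (c' # q # r)"
  using assms reachable_left reachable_right [of q r c p l c']
  by (auto simp: reach_def env2_commute [of q p] split: if_splits)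

lemma reach_decision:
  assumes "reach left (p # l) c (q # r)"
  shows "\<exists>c'\<in>insert 0 C.
    (mv c (env2 p q) = Go c' p \<or> mv c (env2 p q) = Go c' q) \<and> (c \<noteq> 0 \<longrightarrow> c' = c)"
  using assms reachable_decision [of p l c q r] reachable_decision [of q r c p l]
  by (auto simp: reach_def env2_commute [of q p] split: if_splits)

lemma no_swap_right:
  assumes "reach left (p # l) c (q # q' # r)" "mv c (env2 p q) = Go c q"
  shows "mv q (env2 c q') \<noteq> Go q c"
  using assms reachable_no_swap_right [of p l c q q' r] reachable_no_swap_left [of q q' r c p l]
  by (auto simp: reach_def env2_commute [of q p] env2_commute [of q' c] split: if_splits)

lemma no_swap_left:
  assumes "reach left (p # p' # l) c (q # r)" "mv c (env2 p q) = Go c p"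
  shows "mv p (env2 p' c) \<noteq> Go p c"
  using assms reachable_no_swap_left [of p p' l c q r] reachable_no_swap_right [of q r c p p' l]
  by (auto simp: reach_def env2_commute [of q p] env2_commute [of p' c] split: if_splits)

section \<open>Colored vertices and the return from a leaf\<close>

lemma colored_decision:
  assumes "reach left (p # l) c (q # r)" "c \<noteq> 0"
  shows "mv c (env2 p q) = Go c p \<or> mv c (env2 p q) = Go c q"
  using reach_decision [OF assms(1)] assms(2) by auto

text \<open>The leaf must send the agent back to \<open>x\<close>. If \<open>x\<close> sends it on
  to \<open>y\<close>, then \<open>y\<close> sees \<open>x\<close> on both sides and the adversary
  returns it; if \<open>x\<close> sends it to the leaf, the leaf returns it unchanged. Either way
  there is a swap.\<close>

lemma no_alternating_leaf:
  assumes R: "reach True (x # y # x # l) 0 []" and "x \<noteq> 0" "y \<noteq> 0"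
  shows False
proof -
  obtain f where f: "mv 0 (env1 x) = Go f x"
    using leaf_decision [OF R] by blast
  have R1: "reach True (y # x # l) x [f]"
    using reach_return [OF R f] by simp
  from colored_decision [OF R1 \<open>x \<noteq> 0\<close>] show False
  proof
    assume 1: "mv x (env2 y f) = Go x y"
    have "mv y (env2 x x) = Go y x"
      using colored_decision [OF reach_left [OF R1 1]] \<open>y \<noteq> 0\<close> by simp
    with no_swap_left [OF R1 1] show False
      by simp
  next
    assume 1: "mv x (env2 y f) = Go x f"
    have "mv f (env1 x) = Go f x"
      using leaf_decision [OF reach_right [OF R1 1]] f by (cases "f = 0") auto
    with no_swap_leaf [OF R1 1] show False
      by simp
  qed
qed

text \<open>Next to a leaf, a colored vertex must finally retreat, since the leaf always sends the
  agent back. Here \<open>f\<close> is the color of the leaf at that moment, possibly still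
  0.\<close>

lemma leaf_return:
  assumes R: "reach True (q # l) p [0]" and "p \<noteq> 0" "l \<noteq> []"
  shows "\<exists>f\<in>insert 0 C. (f = q \<longrightarrow> q = 0) \<and> mv p (env2 q f) = Go p q \<and> reach True l q [p, f]"
  using colored_decision [OF R \<open>p \<noteq> 0\<close>]
proof
  assume "mv p (env2 q 0) = Go p q"
  with reach_left [OF R this] \<open>l \<noteq> []\<close> show ?thesis
    by (intro bexI [of _ 0]) auto
next
  assume 1: "mv p (env2 q 0) = Go p 0"
  have R1: "reach True (p # q # l) 0 []"
    using reach_right [OF R 1] by simp
  obtain f where f: "mv 0 (env1 p) = Go f p" "f \<in> insert 0 C"
    using leaf_decision [OF R1] by blast
  have R2: "reach True (q # l) p [f]"
    using reach_return [OF R1 f(1)] by simp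
  \<comment> \<open>On a second visit the leaf repeats its answer without a change of color, even if
    \<open>f = 0\<close>, so a second visit would give a swap.\<close>
  have 2: "mv p (env2 q f) \<noteq> Go p f"
  proof
    assume 3: "mv p (env2 q f) = Go p f"
    have "mv f (env1 p) = Go f p"
      using leaf_decision [OF reach_right [OF R2 3]] f by (cases "f = 0") auto
    with no_swap_leaf [OF R2 3] show False
      by simp
  qed
  then have 3: "mv p (env2 q f) = Go p q"
    using colored_decision [OF R2 \<open>p \<noteq> 0\<close>] by simp
  with 2 f(2) reach_left [OF R2 3] \<open>l \<noteq> []\<close> show ?thesis
    by (intro bexI [of _ f]) auto
qed

end

text \<open>\<open>s\<close> is the color given to a vertex all of whose neighbors are uncolored,
  \<open>t\<close> the other one. Only an inclusion is demanded, so \<open>C\<close> may be smaller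
  than \<open>{s, t}\<close>.\<close>

locale two_color_path_explorer = path_explorer +
  fixes s t :: nat
  assumes palette: "insert 0 C \<subseteq> {0, s, t}"
    and distinct_colors: "s \<noteq> 0" "t \<noteq> 0" "s \<noteq> t"
    and first_move: "mv 0 (env2 0 0) = Go s 0"
begin

lemma uncolored_decision:
  assumes "reach left (p # l) 0 (q # r)"
  obtains z where "z \<in> {0, s, t}" "mv 0 (env2 p q) = Go z p \<or> mv 0 (env2 p q) = Go z q"
  using reach_decision [OF assms] palette by blast

text \<open>
  Both positions of the unvisited end are needed: some branches use a leaf ahead of the agent,
  in others it turns back and a leaf may lie behind it.
\<close>

lemma no_return_impossible:
  assumes R_left: "\<And>r. set r \<subseteq> {0} \<Longrightarrow> reach True (t # s # p # l1) 0 r"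
    and R_right: "\<And>r. set r \<subseteq> {0} \<Longrightarrow> r \<noteq> [] \<Longrightarrow> reach False (t # s # l2) 0 r"
    and no_return: "\<And>w r. reach False (s # l2) t (w # r) \<Longrightarrow> mv t (env2 s w) \<noteq> Go t s"
  shows False
proof -
  note col = distinct_colors
  have stays: "mv t (env2 s w) = Go t w" if "reach False (s # l2) t (w # r)" for w r
    using colored_decision [OF that] no_return [OF that] col by blast
  obtain z where z: "z \<in> {0, s, t}"
    and 1: "mv 0 (env2 t 0) = Go z t \<or> mv 0 (env2 t 0) = Go z 0"
    using uncolored_decision [OF R_left [of "[0]"]] by auto
  \<comment> \<open>Every other answer leads to a swap, to a forbidden return from \<open>t\<close>
    to \<open>s\<close>, or to an alternating coloring in front of a leaf.\<close>
  have skip: "mv 0 (env2 t 0) = Go 0 0"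
    using 1
  proof
    assume retreat: "mv 0 (env2 t 0) = Go z t"
    have R: "reach False (s # l2) t [z, 0, 0]"
      using reach_left [OF R_right [of "[0, 0]"]] retreat by simp
    have z_move: "mv t (env2 s z) = Go t z"
      by (rule stays [OF R])
    consider "z = 0" | "z = s" | "z = t"
      using z by blast
    then have False
    proof cases
      case 1
      then show False
        using no_swap_right [OF R z_move] retreat by simp
    next
      case 2
      then show False
        using no_return [OF R] z_move by simp
    next
      case 3
      note R' = reach_right [OF R z_move, unfolded 3, simplified]
      show False
        using colored_decision [OF R' col(2)]
      proof
        assume "mv t (env2 t 0) = Go t t"
        with no_swap_right [OF R z_move] 3 show False
          by simp
      next
        assume onward: "mv t (env2 t 0) = Go t 0"
        have "reach False (t # t # s # l2) 0 [0]"
          using reach_right [OF R' onward] by simp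
        \<comment> \<open>The agent is now at the middle one of three vertices colored
          \<open>t\<close>. It sees only \<open>t\<close>, so the adversary may send it to the first
          one, which by \<open>z_move\<close> points back.\<close>
        from reach_left [OF this] retreat 3 have R'': "reach False (t # s # l2) t [t, 0]"
          by simp
        then have "mv t (env2 t t) = Go t t"
          using colored_decision [OF R'' col(2)] by simp
        with no_swap_left [OF R''] z_move 3 show False
          by simp
      qed
    qed
    then show ?thesis ..
  next
    assume onward: "mv 0 (env2 t 0) = Go z 0"
    have R: "reach True (z # t # s # p # l1) 0 r" if "set r \<subseteq> {0}" for r
      using reach_right [OF R_left [of "0 # r"]] onward that by simp
    consider "z = 0" | "z = s" | "z = t"
      using z by blast
    then show ?thesis
    proof cases
      case 2
      then show ?thesis
        using no_alternating_leaf [of s t "p # l1"] R [of "[]"] col by simp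
    next
      case 3
      have "reach True (t # t # t # s # p # l1) 0 []"
        using reach_right [OF R [of "[0]"]] onward 3 by simp
      then show ?thesis
        using no_alternating_leaf [of t t "s # p # l1"] col by simp
    qed (use onward in simp)
  qed
  \<comment> \<open>Beyond the skipped vertex the agent sees only uncolored neighbors, paints
    \<open>s\<close>, and the adversary sends it back. The skipped vertex then lies between
    \<open>t\<close> and \<open>s\<close>.\<close>
  have fill: "reach left l' 0 [s, 0]" if "l' = t # l" "\<And>r. set r \<subseteq> {0} \<Longrightarrow> r \<noteq> [] \<Longrightarrow> reach left l' 0 r"
    for left l' l
  proof -
    have "reach left (0 # l') 0 [0]"
      using reach_right [of left t l 0 0 "[0]"] that skip by simp
    from reach_left [OF this first_move] that(1) show ?thesis
      by simp
  qed
  have RT: "reach True (t # s # p # l1) 0 [s, 0]"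
    using fill [of "t # s # p # l1" _ True] R_left by simp
  have RF: "reach False (t # s # l2) 0 [s, 0]"
    using fill [of "t # s # l2" _ False] R_right by simp
  obtain z where z: "z \<in> {0, s, t}"
    and 2: "mv 0 (env2 t s) = Go z t \<or> mv 0 (env2 t s) = Go z s"
    using uncolored_decision [OF RT] by auto
  from 2 show False
  proof
    assume retreat: "mv 0 (env2 t s) = Go z t"
    have R: "reach False (s # l2) t [z, s, 0]"
      using reach_left [OF RF retreat] by simp
    have z_move: "mv t (env2 s z) = Go t z"
      by (rule stays [OF R])
    \<comment> \<open>For \<open>z = 0\<close> this is \<open>retreat\<close>; for
      \<open>z = t\<close> it is \<open>z_move\<close> with the neighbors exchanged.\<close>
    have "mv z (env2 t s) = Go z t \<or> z = s"
      using z retreat z_move by (auto simp: env2_commute)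
    then show False
    proof
      assume "mv z (env2 t s) = Go z t"
      with no_swap_right [OF R z_move] show False
        by simp
    next
      assume "z = s"
      with no_return [OF R] z_move show False
        by simp
    qed
  next
    assume onward: "mv 0 (env2 t s) = Go z s"
    have R: "reach True (z # t # s # p # l1) s [0]"
      using reach_right [OF RT onward] by simp
    consider "z = 0" | "z = s" | "z = t"
      using z by blast
    then show False
    proof cases
      case 1
      have "mv s (env2 0 0) = Go s 0"
        using colored_decision [OF R] 1 col by simp
      with no_swap_left [OF R] onward 1 show False
        by simp
    next
      case 2
      obtain f where f: "mv s (env2 s f) = Go s s" "reach True (t # s # p # l1) s [s, f]"
        using leaf_return [OF R] col 2 by auto
      from colored_decision [OF f(2) col(1)] show False
      proof
        assume 3: "mv s (env2 t s) = Go s t"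
        have "mv t (env2 s s) = Go t s"
          using colored_decision [OF reach_left [OF f(2) 3]] col by simp
        with no_swap_left [OF f(2) 3] show False
          by simp
      next
        assume "mv s (env2 t s) = Go s s"
        with no_swap_right [OF f(2)] f(1) show False
          by simp
      qed
    next
      case 3
      obtain f where f: "mv s (env2 t f) = Go s t" "reach True (t # s # p # l1) t [s, f]"
        using leaf_return [OF R] col 3 by auto
      from colored_decision [OF f(2) col(2)] show False
      proof
        \<comment> \<open>Both adjacent vertices colored \<open>t\<close> have one neighbor
          \<open>s\<close> and one neighbor \<open>t\<close>, so they give the same answer and point
          to each other.\<close>
        assume "mv t (env2 t s) = Go t t"
        with no_swap_left [OF f(2)] show False
          by (simp add: env2_commute)
      next
        assume "mv t (env2 t s) = Go t s"
        with no_swap_right [OF f(2)] f(1) show False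
          by simp
      qed
    qed
  qed
qed

lemma inconsistent: False
proof -
  note col = distinct_colors
  have start: "reach left (s # 0 # l) 0 r"
    if "set l \<subseteq> {0}" "set r \<subseteq> {0}" "left \<or> r \<noteq> []" for left l r
    using reach_right [OF reach_start [of "0 # l" "0 # r"] first_move] that by simp
  obtain z where z: "z \<in> {0, s, t}"
    and 1: "mv 0 (env2 s 0) = Go z s \<or> mv 0 (env2 s 0) = Go z 0"
    using uncolored_decision [OF start [of "[]" "[0]" True]] by auto
  from 1 show False
  proof
    assume retreat: "mv 0 (env2 s 0) = Go z s"
    have R: "reach left (0 # l) s (z # 0 # r)"
      if "set l \<subseteq> {0}" "set r \<subseteq> {0}" "\<not> left \<or> l \<noteq> []" "left \<or> r \<noteq> []" for left l r
      using reach_left [OF start [of l "0 # r"] retreat] that by simp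
    consider "z = 0" | "z = s" | "z = t"
      using z by blast
    then show False
    proof cases
      case 1
      note R' = R [of "[0]" "[]" True, simplified, unfolded 1]
      have out: "mv s (env2 0 0) = Go s 0"
        using colored_decision [of True 0 "[0]" s 0 "[0]"] R' col by simp
      show False
        using no_swap_right [of True 0 "[0]" s 0 0 "[]"] R' out retreat 1 by simp
    next
      case 2
      have R0: "reach True [0, 0] s [s, 0, 0]"
        using R [of "[0]" "[0]" True] 2 by simp
      from colored_decision [OF R0 col(1)] show False
      proof
        assume "mv s (env2 0 s) = Go s s"
        with no_swap_right [OF R0] show False
          by (simp add: env2_commute)
      next
        assume out: "mv s (env2 0 s) = Go s 0"
        have "reach True [0] 0 [s, s, 0, 0]"
          using reach_left [OF R0 out] by simp
        from reach_right [OF this] retreat 2 have R1: "reach True [s, 0] s [s, 0, 0]"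
          by (simp add: env2_commute)
        \<comment> \<open>The block of \<open>s\<close> grows by one whenever the agent reaches its
          border. Once it has length four, its two inner vertices see only \<open>s\<close> and form
          a swap.\<close>
        have swap: "mv s (env2 s s) = Go s s"
          using colored_decision [OF R1 col(1)] by simp
        have "reach True [s, s, 0] s [0, 0]"
          using reach_right [OF R1 swap] by simp
        from reach_right [OF this] out have "reach True [s, s, s, 0] 0 [0]"
          by (simp add: env2_commute)
        from reach_left [OF this] retreat 2 have R2: "reach True [s, s, 0] s [s, 0]"
          by simp
        show False
          using no_swap_left [OF R2 swap] swap by simp
      qed
    next
      case 3
      \<comment> \<open>To be used with \<open>p = 0\<close> and \<open>p = t\<close>. Because
        \<open>s\<close> points to \<open>t\<close> here, \<open>t\<close> may never point back to
        \<open>s\<close>, whatever lies beyond it.\<close>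
      have no_p: False
        if R_p: "\<And>left r. set r \<subseteq> {0} \<Longrightarrow> left \<or> r \<noteq> [] \<Longrightarrow> reach left [p, 0] s (t # 0 # r)"
          and turn: "mv s (env2 p t) = Go s t" for p
      proof -
        have "mv t (env2 s 0) \<noteq> Go t s"
          using no_swap_right [of True p "[0]" s t 0 "[0]"] R_p [of "[0]" True] turn by simp
        moreover have R_t: "reach left [s, p, 0] t (0 # r)"
          if "set r \<subseteq> {0}" "left \<or> r \<noteq> []" for left r
          using reach_right [OF R_p [OF that] turn] by simp
        ultimately have "mv t (env2 s 0) = Go t 0"
          using colored_decision [OF R_t [of "[]" True] col(2)] by simp
        then have R_0: "reach left [t, s, p, 0] 0 r" if "set r \<subseteq> {0}" "left \<or> r \<noteq> []" for left r
          using reach_right [OF R_t [OF that]] that by simp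
        show False
        proof (rule no_return_impossible [of p "[0]" "[p, 0]"])
          fix w r
          assume "reach False [s, p, 0] t (w # r)"
          from no_swap_left [OF this] turn show "mv t (env2 s w) \<noteq> Go t s"
            by blast
        qed (use R_0 in simp_all)
      qed
      have R_0: "reach left (0 # l) s (t # 0 # r)"
        if "set l \<subseteq> {0}" "set r \<subseteq> {0}" "l \<noteq> []" "left \<or> r \<noteq> []" for left l r
        using R that 3 by simp
      have "mv s (env2 0 t) = Go s 0 \<or> mv s (env2 0 t) = Go s t"
        using colored_decision [OF R_0 [of "[0]" "[]" True] col(1)] by simp
      then show False
      proof
        assume out: "mv s (env2 0 t) = Go s 0"
        \<comment> \<open>The vertex on the left of \<open>s\<close> also sees \<open>s\<close> and
          0, so it is painted \<open>t\<close> as well and \<open>s\<close> ends up between two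
          \<open>t\<close>.\<close>
        have R_t: "reach left [t, 0] s (t # 0 # r)" if "set r \<subseteq> {0}" "left \<or> r \<noteq> []" for left r
        proof -
          have "reach left [0] 0 (s # t # 0 # r)"
            using reach_left [OF R_0 [of "[0]" r] out] that by simp
          from reach_right [OF this, of t] retreat 3 show ?thesis
            by (simp add: env2_commute)
        qed
        have "mv s (env2 t t) = Go s t"
          using colored_decision [OF R_t [of "[]" True] col(1)] by simp
        with no_p [of t] R_t show False
          by blast
      next
        assume "mv s (env2 0 t) = Go s t"
        with no_p [of 0] R_0 [of "[0]"] show False
          by simp
      qed
    qed
  next
    assume onward: "mv 0 (env2 s 0) = Go z 0"
    have R: "reach left (z # s # 0 # l) 0 r"
      if "set l \<subseteq> {0}" "set r \<subseteq> {0}" "left \<or> r \<noteq> []" for left l r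
      using reach_right [OF start [of l "0 # r"] onward] that by simp
    consider "z = 0" | "z = s" | "z = t"
      using z by blast
    then show False
    proof cases
      case 1
      have "reach True [0, s, 0, 0, 0] 0 [0]"
        using R [of "[0, 0]" "[0]" True] 1 by simp
      from reach_left [OF this] first_move have R0: "reach True [s, 0, 0, 0] 0 [s, 0]"
        by simp
      obtain y where fill: "mv 0 (env2 s s) = Go y s"
        using uncolored_decision [OF R0] by blast
      have R1: "reach True [0, 0, 0] s [y, s, 0]"
        using reach_left [OF R0 fill] by simp
      show False
      proof (cases "y = 0")
        case True
        have "reach True [0, s, 0, 0, 0] s [0]"
          using reach_right [OF R0 fill] True by simp
        \<comment> \<open>Here \<open>s\<close> sees only uncolored neighbors, so the adversary may
          send the agent back to the gap, which points to \<open>s\<close> again.\<close>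
        then show False
          using no_swap_left colored_decision col fill True by fastforce
      next
        case False
        from colored_decision [OF R1 col(1)] show False
        proof
          assume out: "mv s (env2 0 y) = Go s 0"
          \<comment> \<open>The agent now repeats on the left what it did on the right: it skips a
            vertex, paints \<open>s\<close> and fills the gap with \<open>y\<close>. Thus
            \<open>s\<close> gets a \<open>y\<close> on both sides.\<close>
          have "reach True [0, 0] 0 [s, y, s, 0]"
            using reach_left [OF R1 out] by simp
          from reach_left [OF this] onward 1 have "reach True [0] 0 [0, s, y, s, 0]"
            by (simp add: env2_commute)
          from reach_right [OF this] first_move have "reach True [s, 0] 0 [s, y, s, 0]"
            by simp
          from reach_right [OF this] fill have R2: "reach True [y, s, 0] s [y, s, 0]"
            by simp
          have turn: "mv s (env2 y y) = Go s y"
            using colored_decision [OF R2 col(1)] by simp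
          have "mv y (env2 s s) = Go y s"
            using colored_decision [OF reach_right [OF R2 turn]] False by simp
          with no_swap_right [OF R2 turn] show False
            by simp
        next
          assume turn: "mv s (env2 0 y) = Go s y"
          have "mv y (env2 s s) = Go y s"
            using colored_decision [OF reach_right [OF R1 turn]] False by simp
          with no_swap_right [OF R1 turn] show False
            by simp
        qed
      qed
    next
      case 2
      have "reach True [s, s, s, 0] 0 []"
        using reach_right [OF R [of "[]" "[0]" True]] onward 2 by simp
      then show False
        using no_alternating_leaf [of s s "[0]"] col by simp
    next
      case 3
      show False
      \<comment> \<open>The last instance puts the left end of the path directly next to
        \<open>s\<close>, so that \<open>leaf_return\<close> becomes applicable there.\<close>
      proof (rule no_return_impossible [of 0 "[0]" "[0]"])
        fix w r
        assume R': "reach False [s, 0] t (w # r)"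
        show "mv t (env2 s w) \<noteq> Go t s"
        proof
          assume ret: "mv t (env2 s w) = Go t s"
          \<comment> \<open>Seen from the other side, \<open>s\<close> is the neighbor of an
            uncolored leaf, hence must send the agent back to \<open>t\<close>.\<close>
          have "reach True (t # w # r) s [0]"
            using reach_left [OF R' ret] by (simp add: reach_True reach_False)
          then obtain f where "mv s (env2 t f) = Go s t" "reach True (w # r) t [s, f]"
            using leaf_return [of t "w # r" s] col by auto
          with ret no_swap_right [of True w r t s f "[]"] show False
            by (simp add: env2_commute)
        qed
      qed (use R 3 in simp_all)
    qed
  qed
qed

end

section \<open>Reduction of the theorem to two fixed colors\<close>

theorem theorem2:
  shows "\<not> (\<exists>(mv :: algorithm) (C :: nat set).
            is_algorithm mv \<and>
            (\<forall>T :: nat pair_pre_digraph. finite_tree T \<longrightarrow> successfully_explores mv T) \<and>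
            finite C \<and> card C \<le> 2 \<and>
            (\<forall>T :: nat pair_pre_digraph. finite_tree T \<longrightarrow> assigned_colors mv T \<subseteq> C))"
proof
  assume "\<exists>(mv :: algorithm) (C :: nat set).
            is_algorithm mv \<and>
            (\<forall>T :: nat pair_pre_digraph. finite_tree T \<longrightarrow> successfully_explores mv T) \<and>
            finite C \<and> card C \<le> 2 \<and>
            (\<forall>T :: nat pair_pre_digraph. finite_tree T \<longrightarrow> assigned_colors mv T \<subseteq> C)"
  then obtain mv :: algorithm and C :: "nat set" where
    alg: "is_algorithm mv" and C: "finite C" "card C \<le> 2"
    and trees: "\<And>T :: nat pair_pre_digraph. finite_tree T \<Longrightarrow> successfully_explores mv T"
      "\<And>T :: nat pair_pre_digraph. finite_tree T \<Longrightarrow> assigned_colors mv T \<subseteq> C"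
    by blast
  interpret path_explorer mv C
    using alg trees finite_tree_path_graph by unfold_locales auto
  have R0: "reach True [0, 0] 0 [0]"
    by (rule reach_start) auto
  obtain s where s: "s \<in> insert 0 C" "mv 0 (env2 0 0) = Go s 0"
    using reach_decision [OF R0] by blast
  \<comment> \<open>Otherwise two adjacent uncolored vertices would stay uncolored and send the
    agent back and forth.\<close>
  have "s \<noteq> 0"
    using no_swap_left [OF R0] s(2) by auto
  then have "card (C - {s}) \<le> 1"
    using s(1) C by simp
  then obtain t where t: "t \<noteq> 0" "t \<noteq> s" "C - {0, s} \<subseteq> {t}"
  proof (cases "C - {0, s} = {}")
    case True
    then show ?thesis
      \<comment> \<open>If \<open>C\<close> offers no second color, any number other than 0 and
        \<open>s\<close> can serve as \<open>t\<close>.\<close>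
      using that [of "Suc s"] \<open>s \<noteq> 0\<close> by auto
  next
    case False
    then obtain t where "t \<in> C - {0, s}"
      by blast
    moreover have "\<forall>x\<in>C - {s}. \<forall>y\<in>C - {s}. x = y"
      using \<open>card (C - {s}) \<le> 1\<close> C(1) by (simp add: card_le_Suc0_iff_eq)
    ultimately show ?thesis
      using that [of t] by blast
  qed
  then interpret two_color_path_explorer mv C s t
    using s(2) \<open>s \<noteq> 0\<close> by unfold_locales auto
  show False
    by (rule inconsistent)
qed

end
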